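(* Let $G$ be a finite supersolvable group having at least one proper non-trivial subgroup. Then $\gamma(G)\leq p+1$ for some prime divisor $p$ of $|G|$.
   Context: For a group $G$, $V(G)$ denotes the set of all proper non-trivial subgroups of $G$. The intersection graph $\Gamma(G)$ is the simple undirected graph with vertex set $V(G)$ in which two distinct vertices $H,K$ are adjacent if and only if $H\cap K\neq 1$. A dominating set of a graph is a subset $D$ of its vertex set such that every vertex not in $D$ is adjacent to some vertex in $D$. The domination number $\gamma(G)$ is the smallest cardinality of a dominating set of $\Gamma(G)$. *)

theory Defs
  imports "HOL-Algebra.Algebra" "Graph_Theory.Pair_Digraph"
begin

section \<open>Supersolvable groups\<close>

text \<open>
  Every term of the series is required to be normal in the whole group, not merely in the
  next term (which, together with cyclic quotients, would only give a polycyclic group).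
\<close>

definition supersolvable :: "('a, 'b) monoid_scheme \<Rightarrow> bool" where
  "supersolvable G \<longleftrightarrow>
     (\<exists>(n::nat) (H :: nat \<Rightarrow> 'a set).
        H 0 = {\<one>\<^bsub>G\<^esub>} \<and> H n = carrier G \<and>
        (\<forall>i\<le>n. H i \<lhd> G) \<and>
        (\<forall>i<n. H i \<subseteq> H (Suc i) \<and>
               cyclic_group ((G\<lparr>carrier := H (Suc i)\<rparr>) Mod H i)))"

section \<open>The intersection graph of a group\<close>

definition proper_nontrivial_subgroups :: "('a, 'b) monoid_scheme \<Rightarrow> 'a set set" where
  "proper_nontrivial_subgroups G =
     {H. subgroup H G \<and> H \<noteq> carrier G \<and> H \<noteq> {\<one>\<^bsub>G\<^esub>}}"

text \<open>
  A simple undirected graph is represented, as in \<^locale>\<open>pair_graph\<close>, by an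
  irreflexive symmetric set of ordered pairs of vertices.
\<close>

definition intersection_graph :: "('a, 'b) monoid_scheme \<Rightarrow> 'a set pair_pre_digraph" where
  "intersection_graph G =
     \<lparr>pverts = proper_nontrivial_subgroups G,
      parcs = {(H, K). H \<in> proper_nontrivial_subgroups G \<and> K \<in> proper_nontrivial_subgroups G \<and>
                       H \<noteq> K \<and> H \<inter> K \<noteq> {\<one>\<^bsub>G\<^esub>}}\<rparr>"

lemma pair_graph_intersection_graph:
  assumes "finite (carrier G)"
  shows "pair_graph (intersection_graph G)"
proof -
  have fin: "finite (proper_nontrivial_subgroups G)"
    by (rule finite_subset[of _ "Pow (carrier G)"])
       (auto simp: proper_nontrivial_subgroups_def assms dest: subgroup.subset)
  have "finite (parcs (intersection_graph G))"
    by (rule finite_subset[OF _ finite_cartesian_product[OF fin fin]])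
       (auto simp: intersection_graph_def)
  with fin show ?thesis
    by unfold_locales
       (auto simp: intersection_graph_def symmetric_def arcs_ends_conv with_proj_def
             intro!: symI)
qed

section \<open>Domination number\<close>

definition dominating_set :: "'v pair_pre_digraph \<Rightarrow> 'v set \<Rightarrow> bool" where
  "dominating_set \<Gamma> D \<longleftrightarrow>
     D \<subseteq> pverts \<Gamma> \<and> (\<forall>v \<in> pverts \<Gamma> - D. \<exists>u \<in> D. (v, u) \<in> parcs \<Gamma>)"

text \<open>
  The finiteness condition excludes infinite sets, whose \<^const>\<open>card\<close> is \<open>0\<close>. The
  definition is only meaningful for graphs with a finite dominating set, in particular for all
  finite graphs.
\<close>

definition domination_number :: "'v pair_pre_digraph \<Rightarrow> nat" where
  "domination_number \<Gamma> = (LEAST k. \<exists>D. dominating_set \<Gamma> D \<and> finite D \<and> card D = k)"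

end

theory Submission
  imports Defs
begin

text \<open>
  The problem is reduced to a quotient whose order is a product of two primes.

  Dominating sets can be pulled back along an epimorphism \<open>G \<rightarrow> Q\<close>: the preimages of the
  proper non-trivial subgroups of \<open>Q\<close> dominate the intersection graph of \<open>G\<close> as soon as there is
  one such subgroup (\<open>domination_number_le_card_subgroups_of_image\<close>). So it suffices to find a
  quotient of \<open>G\<close> that has at least one, but only few, proper non-trivial subgroups.

  A group of order \<open>p q\<close> with primes \<open>p \<le> q\<close> is such a group. Its proper non-trivial subgroups
  have prime order, so they partition the non-identity elements that they contain, and each of
  them has at least \<open>p - 1\<close> such elements. One of them even has \<open>q - 1\<close>, and this leaves room for
  at most \<open>q\<close> others (\<open>proper_nontrivial_subgroups_order_two_primes\<close>).

  A finite supersolvable group has a quotient of this kind unless its order is \<open>1\<close> or a prime: its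
  series with cyclic factors can be refined, because a subgroup of a cyclic normal section
  is determined by its order and hence stays normal in the whole group
  (\<open>normal_subgroup_in_cyclic_section\<close>). The refined series goes down from \<open>G\<close> one prime at a
  time, and its second step has index \<open>p q\<close>
  (\<open>supersolvable_normal_subgroup_index_two_primes\<close>).
\<close>

section \<open>Pulling dominating sets back along an epimorphism\<close>

lemma domination_number_le_card:
  assumes "dominating_set \<Gamma> D" "finite D"
  shows "domination_number \<Gamma> \<le> card D"
  unfolding domination_number_def using assms by (intro Least_le) blast

lemma subgroup_nontrivial_element:
  assumes "subgroup H G" "H \<noteq> {\<one>\<^bsub>G\<^esub>}"
  obtains x where "x \<in> H" "x \<noteq> \<one>\<^bsub>G\<^esub>"
  using assms subgroup.one_closed by blast

lemma (in group_hom) subgroup_preimage: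
  assumes "subgroup L H"
  shows "subgroup {x \<in> carrier G. h x \<in> L} G"
  using assms by (intro G.subgroupI) (auto simp: subgroup_def)

text \<open>
  A subgroup \<open>U\<close> of the source is met by some preimage because its image is met by some proper
  non-trivial subgroup of the target: by itself, or by an arbitrary one if \<open>U\<close> maps onto the
  target. A common element other than the identity then lifts to an element of \<open>U\<close>, which is not
  the identity either. If the image is trivial, \<open>U\<close> lies in the kernel and so in every preimage.
\<close>

lemma (in group_hom) domination_number_le_card_subgroups_of_image:
  assumes surj: "h ` carrier G = carrier H"
    and finH: "finite (carrier H)"
    and ne: "proper_nontrivial_subgroups H \<noteq> {}"
  shows "domination_number (intersection_graph G) \<le> card (proper_nontrivial_subgroups H)"
proof -
  define pre where "pre L = {x \<in> carrier G. h x \<in> L}" for L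
  define D where "D = pre ` proper_nontrivial_subgroups H"
  have finV: "finite (proper_nontrivial_subgroups H)"
    by (rule finite_subset[of _ "Pow (carrier H)"])
       (auto simp: proper_nontrivial_subgroups_def finH dest: subgroup.subset)
  have pre: "pre L \<in> proper_nontrivial_subgroups G" if L: "L \<in> proper_nontrivial_subgroups H" for L
  proof -
    have sub: "subgroup L H" and proper: "L \<noteq> carrier H" and nontriv: "L \<noteq> {\<one>\<^bsub>H\<^esub>}"
      using L by (auto simp: proper_nontrivial_subgroups_def)
    obtain y where y: "y \<in> L" "y \<noteq> \<one>\<^bsub>H\<^esub>"
      using subgroup_nontrivial_element[OF sub nontriv] .
    have LH: "L \<subseteq> carrier H" using sub by (rule subgroup.subset)
    with y surj have "y \<in> h ` carrier G" by auto
    then obtain x where x: "x \<in> carrier G" "h x = y" by auto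
    have "x \<in> pre L" "x \<noteq> \<one>" using x y by (auto simp: pre_def)
    moreover have "\<not> h ` carrier G \<subseteq> L" using LH proper surj by auto
    then obtain w where "w \<in> carrier G" "h w \<notin> L" by auto
    ultimately show ?thesis
      using subgroup_preimage[OF sub] by (auto simp: proper_nontrivial_subgroups_def pre_def)
  qed
  have meets: "\<exists>L \<in> proper_nontrivial_subgroups H. U \<inter> pre L \<noteq> {\<one>}"
    if U: "U \<in> proper_nontrivial_subgroups G" for U
  proof -
    have subU: "subgroup U G" and nontriv: "U \<noteq> {\<one>}"
      using U by (auto simp: proper_nontrivial_subgroups_def)
    have UG: "U \<subseteq> carrier G" using subU by (rule subgroup.subset)
    have sub_img: "subgroup (h ` U) H" by (rule subgroup_img_is_subgroup[OF subU])
    obtain L0 where L0: "L0 \<in> proper_nontrivial_subgroups H" using ne by blast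
    show ?thesis
    proof (cases "h ` U = {\<one>\<^bsub>H\<^esub>}")
      case True
      have "\<one>\<^bsub>H\<^esub> \<in> L0"
        using L0 by (auto simp: proper_nontrivial_subgroups_def subgroup.one_closed)
      moreover have "h x = \<one>\<^bsub>H\<^esub>" if "x \<in> U" for x using True that by blast
      ultimately have "U \<subseteq> pre L0" using UG by (auto simp: pre_def)
      then have "U \<inter> pre L0 \<noteq> {\<one>}" using nontriv by (simp add: Int_absorb2)
      then show ?thesis using L0 by blast
    next
      case False
      obtain L where L: "L \<in> proper_nontrivial_subgroups H" "L \<subseteq> h ` U"
      proof (cases "h ` U = carrier H")
        case True
        have "L0 \<subseteq> carrier H"
          using L0 by (auto simp: proper_nontrivial_subgroups_def dest: subgroup.subset)
        with True L0 show ?thesis using that by blast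
      next
        case False
        with \<open>h ` U \<noteq> {\<one>\<^bsub>H\<^esub>}\<close> sub_img that show ?thesis
          by (auto simp: proper_nontrivial_subgroups_def)
      qed
      then obtain y where y: "y \<in> L" "y \<noteq> \<one>\<^bsub>H\<^esub>"
        by (auto simp: proper_nontrivial_subgroups_def elim: subgroup_nontrivial_element)
      then obtain x where x: "x \<in> U" "h x = y" using L(2) by blast
      have "x \<in> U \<inter> pre L" "x \<noteq> \<one>" using x y UG by (auto simp: pre_def)
      then show ?thesis using L(1) by blast
    qed
  qed
  have "dominating_set (intersection_graph G) D"
    unfolding dominating_set_def
  proof (intro conjI ballI)
    show "D \<subseteq> pverts (intersection_graph G)"
      using pre by (auto simp: D_def intersection_graph_def)
  next
    fix U assume "U \<in> pverts (intersection_graph G) - D"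
    then have U: "U \<in> proper_nontrivial_subgroups G" "U \<notin> D"
      by (auto simp: intersection_graph_def)
    then obtain L where L: "L \<in> proper_nontrivial_subgroups H" "U \<inter> pre L \<noteq> {\<one>}"
      using meets by blast
    then have "(U, pre L) \<in> parcs (intersection_graph G)"
      using U pre[OF L(1)] by (auto simp: intersection_graph_def D_def)
    then show "\<exists>K \<in> D. (U, K) \<in> parcs (intersection_graph G)"
      using L(1) by (auto simp: D_def)
  qed
  then have "domination_number (intersection_graph G) \<le> card D"
    using finV by (intro domination_number_le_card) (auto simp: D_def)
  also have "\<dots> \<le> card (proper_nontrivial_subgroups H)"
    unfolding D_def by (rule card_image_le[OF finV])
  finally show ?thesis .
qed

section \<open>Groups whose order is a product of two primes\<close>

lemma (in group) prime_order_imp_no_proper_nontrivial_subgroups: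
  assumes "Factorial_Ring.prime (order G)"
  shows "proper_nontrivial_subgroups G = {}"
proof -
  have fin: "finite (carrier G)"
    using prime_gt_0_nat[OF assms] order_gt_0_iff_finite by simp
  have "H = {\<one>} \<or> H = carrier G" if H: "subgroup H G" for H
  proof -
    have "card H dvd order G" using lagrange[OF H] by (metis dvd_triv_right)
    then consider "card H = 1" | "card H = card (carrier G)"
      using assms unfolding prime_nat_iff order_def by blast
    then show ?thesis
    proof cases
      case 1
      then show ?thesis
        using subgroup.one_closed[OF H] by (metis card_1_singletonE singletonD)
    next
      case 2
      then show ?thesis
        using card_subset_eq[OF fin subgroup.subset[OF H]] by simp
    qed
  qed
  then show ?thesis by (auto simp: proper_nontrivial_subgroups_def)
qed

lemma dvd_product_of_two_primes:
  fixes d p q :: nat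
  assumes "d dvd p * q" "Factorial_Ring.prime p" "Factorial_Ring.prime q" "d \<noteq> 1" "d \<noteq> p * q"
  shows "d = p \<or> d = q"
proof -
  obtain b c where "d = b * c" "b dvd p" "c dvd q" using division_decomp[OF assms(1)] by blast
  moreover from this have "b = 1 \<or> b = p" "c = 1 \<or> c = q"
    using assms(2,3) unfolding prime_nat_iff by blast+
  ultimately show ?thesis using assms(4,5) by auto
qed

lemma (in group) card_subgroup_dvd_card_subgroup:
  assumes "subgroup H G" "subgroup K G" "H \<subseteq> K"
  shows "card H dvd card K"
proof -
  interpret K: group "G\<lparr>carrier := K\<rparr>" by (rule subgroup_imp_group[OF assms(2)])
  show ?thesis
    using K.lagrange[OF subgroup_incl[OF assms]] by (simp add: order_def) (metis dvd_triv_right)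
qed

text \<open>
  Distinct proper non-trivial subgroups have prime orders and so meet trivially. Counting the
  non-identity elements in all \<open>n\<close> of them, with one subgroup of order \<open>q\<close> supplied by Sylow's
  theorem, gives \<open>(n - 1) (p - 1) + (q - 1) \<le> p q - 1\<close>, that is, \<open>n - 1 \<le> q\<close>.
\<close>

lemma (in group) proper_nontrivial_subgroups_order_two_primes:
  assumes p: "Factorial_Ring.prime p" and q: "Factorial_Ring.prime q" and "p \<le> q"
    and order: "order G = p * q"
  shows "proper_nontrivial_subgroups G \<noteq> {}"
    and "card (proper_nontrivial_subgroups G) \<le> q + 1"
proof -
  define V where "V = proper_nontrivial_subgroups G"
  have p2: "2 \<le> p" and q2: "2 \<le> q" using p q by (simp_all add: prime_ge_2_nat)
  have finG: "finite (carrier G)"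
    using order p2 q2 order_gt_0_iff_finite by simp
  have finV: "finite V"
    by (rule finite_subset[of _ "Pow (carrier G)"])
       (auto simp: V_def proper_nontrivial_subgroups_def finG dest: subgroup.subset)
  have sub: "subgroup K G" if "K \<in> V" for K
    using that by (simp add: V_def proper_nontrivial_subgroups_def)
  have fin: "finite K" if "K \<in> V" for K
    using sub[OF that] finG finite_subset subgroup.subset by blast
  have card_V: "card K = p \<or> card K = q" if K: "K \<in> V" for K
  proof (rule dvd_product_of_two_primes[OF _ p q])
    show "card K dvd p * q"
      using lagrange[OF sub[OF K]] order by (metis dvd_triv_right)
    show "card K \<noteq> 1"
      using K subgroup.one_closed[OF sub[OF K]]
      by (auto simp: V_def proper_nontrivial_subgroups_def card_1_singleton_iff)
    show "card K \<noteq> p * q"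
      using K card_subset_eq[OF finG subgroup.subset[OF sub[OF K]]] order
      by (auto simp: V_def proper_nontrivial_subgroups_def order_def)
  qed
  have disj: "K \<inter> L = {\<one>}" if "K \<in> V" "L \<in> V" "K \<noteq> L" for K L
  proof (rule ccontr)
    assume nontriv: "K \<inter> L \<noteq> {\<one>}"
    have I: "subgroup (K \<inter> L) G" using that sub subgroups_Inter_pair by blast
    have "card (K \<inter> L) \<noteq> 1"
      using nontriv subgroup.one_closed[OF I] by (metis card_1_singletonE singletonD)
    moreover have "card (K \<inter> L) dvd card K" "card (K \<inter> L) dvd card L"
      using that sub I by (auto intro: card_subgroup_dvd_card_subgroup)
    ultimately have "card (K \<inter> L) = card K" "card (K \<inter> L) = card L"
      using card_V[OF that(1)] card_V[OF that(2)] p q unfolding prime_nat_iff by auto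
    then have "K \<inter> L = K" "K \<inter> L = L"
      using card_subset_eq[OF fin[OF that(1)] Int_lower1] card_subset_eq[OF fin[OF that(2)] Int_lower2]
      by blast+
    with \<open>K \<noteq> L\<close> show False by simp
  qed
  obtain Q where Q: "subgroup Q G" "card Q = q"
    using sylow_thm[OF q is_group _ finG, of 1 p] order by (auto simp: mult.commute)
  have QV: "Q \<in> V"
    unfolding V_def proper_nontrivial_subgroups_def
    using Q order p2 q2 by (auto simp: order_def)
  then show "proper_nontrivial_subgroups G \<noteq> {}" unfolding V_def by blast
  have card_diff: "card (K - {\<one>}) = card K - 1" if "K \<in> V" for K
    using subgroup.one_closed[OF sub[OF that]] fin[OF that] by simp
  have "(card V - 1) * (p - 1) + (q - 1) \<le> (\<Sum>K\<in>V - {Q}. card (K - {\<one>})) + card (Q - {\<one>})"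
  proof -
    have "of_nat (card V - 1) * (p - 1) \<le> (\<Sum>K\<in>V - {Q}. card (K - {\<one>}))"
      unfolding card_Diff_singleton[OF QV, symmetric]
    proof (rule sum_bounded_below)
      fix K assume "K \<in> V - {Q}"
      then have K: "K \<in> V" by simp
      show "p - 1 \<le> card (K - {\<one>})"
        unfolding card_diff[OF K] using card_V[OF K] \<open>p \<le> q\<close> by linarith
    qed
    then show ?thesis
      unfolding card_diff[OF QV] Q(2) of_nat_id by (rule add_right_mono)
  qed
  also have "\<dots> = (\<Sum>K\<in>V. card (K - {\<one>}))"
    using sum.remove[OF finV QV, of "\<lambda>K. card (K - {\<one>})"] by linarith
  also have "\<dots> = card (\<Union>K\<in>V. K - {\<one>})"
    using finV fin disj by (intro card_UN_disjoint[symmetric]) auto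
  also have "\<dots> \<le> card (carrier G - {\<one>})"
  proof (rule card_mono)
    show "(\<Union>K\<in>V. K - {\<one>}) \<subseteq> carrier G - {\<one>}"
      using subgroup.subset[OF sub] by blast
  qed (use finG in simp)
  also have "\<dots> = p * q - 1" using finG order by (simp add: order_def)
  finally have "(card V - 1) * (p - 1) + (q - 1) \<le> p * q - 1" .
  moreover have "p * q = q * (p - 1) + q"
    using p2 by (metis add.commute mult.commute mult_eq_if not_numeral_le_zero)
  ultimately have "(card V - 1) * (p - 1) \<le> q * (p - 1)" using q2 by linarith
  then have "card V - 1 \<le> q" using p2 mult_le_cancel2[of "card V - 1" "p - 1" q] by linarith
  then show "card (proper_nontrivial_subgroups G) \<le> q + 1" unfolding V_def by simp
qed

section \<open>Normal subgroups inside a cyclic section\<close>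

lemma (in group_hom) card_image_mult_card_kernel:
  "card (h ` carrier G) * card (kernel G H h) = order G"
proof -
  let ?I = "H\<lparr>carrier := h ` carrier G\<rparr>"
  interpret I: group_hom G ?I h
    by (intro group_hom.intro group_hom_axioms.intro G.is_group
          H.subgroup_imp_group[OF img_is_subgroup]) (auto simp: hom_def)
  have ker: "kernel G ?I h = kernel G H h" by (simp add: kernel_def)
  have "G Mod kernel G H h \<cong> ?I" using I.FactGroup_iso by (simp add: ker)
  then have "order (G Mod kernel G H h) = card (h ` carrier G)"
    using iso_same_card by (fastforce simp: order_def)
  then show ?thesis
    using G.lagrange[OF subgroup_kernel] by (simp add: order_def FactGroup_def)
qed

lemma (in group) conjugate_nat_pow:
  assumes "g \<in> carrier G" "x \<in> carrier G"
  shows "(g \<otimes> x \<otimes> inv g) [^] (n::nat) = g \<otimes> x [^] n \<otimes> inv g"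
proof (induction n)
  case (Suc n)
  have "inv g \<otimes> (g \<otimes> (x \<otimes> inv g)) = x \<otimes> inv g"
    using assms by (simp add: m_assoc[symmetric])
  then show ?case using Suc assms by (simp add: m_assoc)
qed (use assms in simp)

lemma (in group) cyclic_card_powers:
  assumes fin: "finite (carrier G)" and cyc: "cyclic_group G" and order: "order G = d * e"
  shows "card ((\<lambda>c. c [^] e) ` carrier G) = d"
proof -
  obtain g where g: "g \<in> carrier G" and gen: "subgroup_generated G {g} = G"
    using cyc unfolding cyclic_group_def by blast
  have ord: "ord g = d * e" using cyclic_order_is_ord[OF g] gen order by simp
  have pos: "0 < d * e" using fin order order_gt_0_iff_finite by simp
  have "carrier G = generate G {g}"
    using gen g carrier_subgroup_generated[of G "{g}"] by simp
  then have carrier: "carrier G = range (\<lambda>k::nat. g [^] k)"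
    using generate_pow_on_finite_carrier[OF fin g] by auto
  have "(\<lambda>c. c [^] e) ` carrier G = range (\<lambda>k::nat. (g [^] e) [^] k)"
    unfolding carrier image_image using g by (simp add: nat_pow_pow mult.commute)
  also have "\<dots> = generate G {g [^] e}"
    using generate_pow_on_finite_carrier[OF fin, of "g [^] e"] g by auto
  finally show ?thesis
    using generate_pow_card[of "g [^] e"] ord_pow_gen[OF g, of e] g ord pos by simp
qed

text \<open>
  In the cyclic group \<open>B / A\<close> of order \<open>d e\<close> the elements killed by \<open>e\<close> form the subgroup of order
  \<open>e\<close>: it is the kernel of the \<open>e\<close>-th power map, whose image has order \<open>d\<close>. The preimage of this
  subgroup in \<open>B\<close> is \<open>{x \<in> B. x\<^sup>e \<in> A}\<close>, and this description is visibly invariant under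
  conjugation by all of \<open>G\<close> when \<open>A\<close> and \<open>B\<close> are.
\<close>

lemma (in group) normal_subgroup_in_cyclic_section:
  assumes fin: "finite (carrier G)" and A: "A \<lhd> G" and B: "B \<lhd> G" and "A \<subseteq> B"
    and cyc: "cyclic_group ((G\<lparr>carrier := B\<rparr>) Mod A)"
    and card: "card B = d * e * card A"
  obtains N where "N \<lhd> G" "card N = e * card A"
proof -
  let ?B = "G\<lparr>carrier := B\<rparr>"
  let ?C = "?B Mod A"
  have subA: "subgroup A G" and subB: "subgroup B G"
    using A B by (simp_all add: normal_imp_subgroup)
  have BG: "B \<subseteq> carrier G" using subB by (rule subgroup.subset)
  have finB: "finite B" using BG fin by (rule finite_subset)
  have "0 < card B" using finB subgroup.one_closed[OF subB] card_gt_0_iff by blast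
  then have pos: "0 < d" "0 < card A" using card by simp_all
  interpret B: group ?B by (rule subgroup_imp_group[OF subB])
  interpret A: normal A ?B by (rule normal_restrict_supergroup[OF subB A \<open>A \<subseteq> B\<close>])
  interpret C: group ?C by (rule A.factorgroup_is_group)
  interpret C: comm_group ?C by (rule C.cyclic_imp_abelian_group[OF cyc])
  define f where "f x = (A #>\<^bsub>?B\<^esub> x) [^]\<^bsub>?C\<^esub> e" for x
  interpret f: group_hom ?B ?C f
  proof
    show "f \<in> hom ?B ?C"
    proof (rule homI)
      fix x y assume xy: "x \<in> carrier ?B" "y \<in> carrier ?B"
      show "f x \<in> carrier ?C"
        unfolding f_def by (intro C.nat_pow_closed hom_in_carrier[OF A.r_coset_hom_Mod] xy)
      show "f (x \<otimes>\<^bsub>?B\<^esub> y) = f x \<otimes>\<^bsub>?C\<^esub> f y"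
        unfolding f_def hom_mult[OF A.r_coset_hom_Mod xy]
        by (intro C.nat_pow_distrib hom_in_carrier[OF A.r_coset_hom_Mod] xy)
    qed
  qed
  define N where "N = kernel ?B ?C f"
  have N_iff: "x \<in> N \<longleftrightarrow> x \<in> B \<and> x [^] e \<in> A" for x
  proof -
    have "A #>\<^bsub>?B\<^esub> x [^] e = A \<longleftrightarrow> x [^] e \<in> A" if "x \<in> B"
    proof -
      have "x [^] e \<in> B"
        using B.nat_pow_closed[of x e] that by (simp add: nat_pow_consistent[symmetric])
      then show ?thesis
        using B.coset_join1[OF _ _ A.subgroup_axioms, of "x [^] e"]
          B.coset_join2[OF _ A.subgroup_axioms, of "x [^] e"] by auto
    qed
    then show ?thesis
      using A.FactGroup_pow[of x e]
      by (auto simp: N_def kernel_def f_def nat_pow_consistent[symmetric])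
  qed
  have "card (carrier ?C) * card A = card B"
    using B.lagrange[OF A.subgroup_axioms] by (simp add: FactGroup_def order_def)
  then have orderC: "order ?C = d * e" using card pos by (simp add: order_def)
  have finC: "finite (carrier ?C)" using finB by (simp add: carrier_FactGroup)
  have "f ` carrier ?B = (\<lambda>c. c [^]\<^bsub>?C\<^esub> e) ` carrier ?C"
    by (auto simp: f_def carrier_FactGroup)
  then have "card (f ` carrier ?B) = d"
    using C.cyclic_card_powers[OF finC cyc orderC] by simp
  then have "d * card N = d * (e * card A)"
    using f.card_image_mult_card_kernel card by (simp add: N_def order_def mult.assoc)
  then have "card N = e * card A" using pos by simp
  moreover have "N \<lhd> G"
    unfolding normal_inv_iff
  proof (intro conjI ballI)
    show "subgroup N G"
      using incl_subgroup[OF subB] f.subgroup_kernel by (simp add: N_def)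
    fix g x assume g: "g \<in> carrier G" and x: "x \<in> N"
    then have "g \<otimes> x \<otimes> inv g \<in> B" "g \<otimes> x [^] e \<otimes> inv g \<in> A" "x \<in> carrier G"
      using A B BG by (auto simp: N_iff normal_inv_iff)
    then show "g \<otimes> x \<otimes> inv g \<in> N"
      using g by (simp add: N_iff conjugate_nat_pow)
  qed
  ultimately show ?thesis using that by blast
qed

text \<open>
  Take the last term \<open>H i\<close> of the series whose index in \<open>G\<close> is neither \<open>1\<close> nor a prime. The index
  of \<open>H (i + 1)\<close> is then \<open>1\<close> or a prime, so that the missing two primes or one prime
  have to be taken from the order \<open>m\<close> of the cyclic factor \<open>H (i + 1) / H i\<close>, and a subgroup
  between \<open>H i\<close> and \<open>H (i + 1)\<close> does this.
\<close>

lemma (in group) supersolvable_normal_subgroup_index_two_primes: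
  assumes fin: "finite (carrier G)" and "supersolvable G"
    and "order G \<noteq> 1" "\<not> Factorial_Ring.prime (order G)"
  obtains N p q where "N \<lhd> G" "Factorial_Ring.prime p" "Factorial_Ring.prime q" "p \<le> q"
    "order G = p * q * card N"
proof -
  obtain n and H :: "nat \<Rightarrow> 'a set" where series: "H 0 = {\<one>} \<and> H n = carrier G \<and>
      (\<forall>i\<le>n. H i \<lhd> G) \<and>
      (\<forall>i<n. H i \<subseteq> H (Suc i) \<and> cyclic_group ((G\<lparr>carrier := H (Suc i)\<rparr>) Mod H i))"
    using assms(2) unfolding supersolvable_def by (elim exE) (rule that)
  then have H0: "H 0 = {\<one>}" and Hn: "H n = carrier G"
    and H: "\<And>i. i \<le> n \<Longrightarrow> H i \<lhd> G"
    and step: "\<And>i. i < n \<Longrightarrow> H i \<subseteq> H (Suc i)"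
      "\<And>i. i < n \<Longrightarrow> cyclic_group ((G\<lparr>carrier := H (Suc i)\<rparr>) Mod H i)"
    by simp_all
  have pos: "0 < order G" using fin order_gt_0_iff_finite by simp
  define ix where "ix i = order G div card (H i)" for i
  have ix: "order G = ix i * card (H i)" if "i \<le> n" for i
    using lagrange[OF normal_imp_subgroup[OF H[OF that]]]
    unfolding ix_def by (metis dvd_div_mult_self dvd_triv_right)
  define I where "I = {i. i \<le> n \<and> ix i \<noteq> 1 \<and> \<not> Factorial_Ring.prime (ix i)}"
  have finI: "finite I" by (simp add: I_def)
  have "0 \<in> I" using assms(3,4) by (simp add: I_def ix_def H0)
  define i where "i = Max I"
  have "i \<in> I" using Max_in[OF finI] \<open>0 \<in> I\<close> unfolding i_def by blast
  then have i: "i \<le> n" "ix i \<noteq> 1" "\<not> Factorial_Ring.prime (ix i)" by (simp_all add: I_def)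
  have "ix n = 1" using pos by (simp add: ix_def Hn order_def)
  then have "i < n" using i by (cases "i = n") auto
  have "Suc i \<notin> I" using Max_ge[OF finI, of "Suc i"] unfolding i_def by auto
  then have next_ix: "ix (Suc i) = 1 \<or> Factorial_Ring.prime (ix (Suc i))"
    using \<open>i < n\<close> by (auto simp: I_def)
  have "card (H i) dvd card (H (Suc i))"
    using card_subgroup_dvd_card_subgroup[OF normal_imp_subgroup[OF H]
        normal_imp_subgroup[OF H] step(1), of i] \<open>i < n\<close>
    by simp
  then obtain m where m: "card (H (Suc i)) = m * card (H i)"
    by (metis dvdE mult.commute)
  have ix_i: "ix i = ix (Suc i) * m"
    using ix[of i] ix[of "Suc i"] m \<open>i < n\<close> pos by auto
  \<comment> \<open>\<open>d\<close> will be the index of \<open>N\<close> in \<open>H (Suc i)\<close>: one prime divisor of \<open>m\<close>, or the product of two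
    if \<open>H (Suc i)\<close> is already all of \<open>G\<close>.\<close>
  obtain p q d e where pq: "Factorial_Ring.prime p" "Factorial_Ring.prime q"
    and d: "ix (Suc i) * d = p * q" and e: "m = d * e"
  proof (cases "ix (Suc i) = 1")
    case True
    then have "m \<noteq> 1" "\<not> Factorial_Ring.prime m" using i ix_i by simp_all
    then obtain p k where p: "Factorial_Ring.prime p" "m = p * k"
      using prime_factor_nat by (metis dvdE)
    then have "k \<noteq> 1" using \<open>\<not> Factorial_Ring.prime m\<close> by auto
    then obtain q e where q: "Factorial_Ring.prime q" "k = q * e"
      using prime_factor_nat by (metis dvdE)
    show ?thesis
      by (rule that[of p q "p * q" e]) (use p q True in simp_all)
  next
    case False
    then have r: "Factorial_Ring.prime (ix (Suc i))" using next_ix by simp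
    then have "m \<noteq> 1" using i ix_i by auto
    then obtain q e where q: "Factorial_Ring.prime q" "m = q * e"
      using prime_factor_nat by (metis dvdE)
    show ?thesis
      by (rule that[of "ix (Suc i)" q q e]) (use r q in simp_all)
  qed
  obtain N where N: "N \<lhd> G" "card N = e * card (H i)"
    using normal_subgroup_in_cyclic_section[OF fin H H step, of i d e] \<open>i < n\<close> m e by auto
  have "order G = p * q * card N"
    using ix[of i] ix_i \<open>i < n\<close> N(2) d e by (simp add: mult.assoc[symmetric])
  then show ?thesis
    using that[OF N(1), of p q] that[OF N(1), of q p] pq
    by (cases "p \<le> q") (auto simp: mult.commute)
qed

section \<open>The bound for supersolvable groups\<close>

theorem proposition4p4:
  fixes G :: "('a, 'b) monoid_scheme"
  assumes "group G"
    and "finite (carrier G)"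
    and "supersolvable G"
    and "proper_nontrivial_subgroups G \<noteq> {}"
  shows "\<exists>p::nat. Factorial_Ring.prime p \<and> p dvd order G \<and>
           domination_number (intersection_graph G) \<le> p + 1"
proof -
  interpret group G by fact
  obtain K where K: "subgroup K G" "K \<noteq> carrier G" "K \<noteq> {\<one>\<^bsub>G\<^esub>}"
    using assms(4) by (auto simp: proper_nontrivial_subgroups_def)
  have "order G \<noteq> 1"
  proof
    assume "order G = 1"
    then have "carrier G = {\<one>\<^bsub>G\<^esub>}" by (simp only: order_one_triv_iff)
    with subgroup.subset[OF K(1)] have "K \<subseteq> {\<one>\<^bsub>G\<^esub>}" by simp
    with K subgroup.one_closed[OF K(1)] show False by blast
  qed
  moreover have "\<not> Factorial_Ring.prime (order G)"
    using prime_order_imp_no_proper_nontrivial_subgroups assms(4) by blast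
  ultimately obtain N p q where N: "N \<lhd> G"
    and pq: "Factorial_Ring.prime p" "Factorial_Ring.prime q" "p \<le> q"
    and order: "order G = p * q * card N"
    using supersolvable_normal_subgroup_index_two_primes[OF assms(2,3)] by blast
  interpret N: normal N G by (rule N)
  interpret Q: group "G Mod N" by (rule N.factorgroup_is_group)
  interpret proj: group_hom G "G Mod N" "\<lambda>x. N #>\<^bsub>G\<^esub> x"
    by unfold_locales (rule N.r_coset_hom_Mod)
  have "0 < order G" using assms(2) order_gt_0_iff_finite by simp
  then have order_Q: "order (G Mod N) = p * q"
    using lagrange[OF N.subgroup_axioms] order by (simp add: order_def FactGroup_def)
  have finQ: "finite (carrier (G Mod N))" using assms(2) by (simp add: carrier_FactGroup)
  note two_primes = Q.proper_nontrivial_subgroups_order_two_primes[OF pq order_Q]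
  have "domination_number (intersection_graph G) \<le> card (proper_nontrivial_subgroups (G Mod N))"
    by (rule proj.domination_number_le_card_subgroups_of_image[OF _ finQ two_primes(1)])
       (simp add: carrier_FactGroup)
  with two_primes(2) have "domination_number (intersection_graph G) \<le> q + 1" by simp
  moreover have "q dvd order G" using order by simp
  ultimately show ?thesis using pq(2) by blast
qed

end
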